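(* Let $n\ge0$ and let $(m_{j,k})_{0\le j,k\le n}$ be the change of basis matrix from the shifted Legendre polynomials $\{P_0^*(x),\ldots,P_n^*(x)\}$ to the Bernstein polynomials $\{b_0^n(x),\ldots,b_n^n(x)\}$, i.e. $P_k^*(x)=\sum_{j=0}^n m_{j,k}\,b_j^n(x)$. Then for all $0\le j,k\le n$, $$m_{j,k}=(-1)^k\,{}_3F_2\!\left[\begin{matrix}-k,\;1+k,\;-j\\ 1,\;-n\end{matrix};1\right].$$
   Context: $P_k^*(x)=P_k(2x-1)$ where $P_k$ is the Legendre polynomial; $b_j^n(x)=\binom{n}{j}x^j(1-x)^{n-j}$. The hypergeometric series denotes the terminating sum $\sum_{v=0}^{\min\{j,k\}}\frac{(-k)_v(1+k)_v(-j)_v}{(1)_v(-n)_v\,v!}$, with $(a)_v=a(a+1)\cdots(a+v-1)$. *)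

theory Defs
  imports "HOL-Analysis.Analysis" "HOL-Computational_Algebra.Polynomial"
begin

(* Rodrigues' formula: P_k(x) = 1 / (2^k k!) * (d/dx)^k (x^2 - 1)^k. *)
definition legendre_poly :: "nat \<Rightarrow> real poly" where
  "legendre_poly k = smult (1 / (2 ^ k * fact k)) ((pderiv ^^ k) ([:-1, 0, 1:] ^ k))"

definition shifted_legendre_poly :: "nat \<Rightarrow> real poly" where
  "shifted_legendre_poly k = legendre_poly k \<circ>\<^sub>p [:-1, 2:]"

(* The partial sum over v <= N of the series 3F2(a1, a2, a3; b1, b2; z).  The cut-off is
   explicit because a lower parameter may be a negative integer -n, for which the terms
   with v > n are undefined (division by zero). *)
definition hyp3F2_upto :: "nat \<Rightarrow> real \<Rightarrow> real \<Rightarrow> real \<Rightarrow> real \<Rightarrow> real \<Rightarrow> real \<Rightarrow> real" where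
  "hyp3F2_upto N a1 a2 a3 b1 b2 z =
     (\<Sum>v\<le>N. pochhammer a1 v * pochhammer a2 v * pochhammer a3 v
            / (pochhammer b1 v * pochhammer b2 v * fact v) * z ^ v)"

end

theory Submission
  imports Defs
begin

text \<open>
  The idea is to pass through the monomial basis. After the substitution \<open>y = 2x - 1\<close> the
  Rodrigues formula reads \<open>P_k^*(x) = (1/k!) (d/dx)^k (x (x - 1))^k\<close>, because
  \<open>y^2 - 1 = 4 x (x - 1)\<close> and the chain rule cancels the powers of two
  (\<open>shifted_legendre_poly_rodrigues\<close>). Expanding \<open>(x - 1)^k\<close> gives the coefficient of \<open>x^v\<close> in
  closed form, and that coefficient is exactly \<open>(-1)^k (-k)_v (1+k)_v / ((1)_v v!)\<close>
  (\<open>coeff_shifted_legendre_poly\<close>).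

  The remaining quotient \<open>(-j)_v / (-n)_v\<close> of the hypergeometric term is the coefficient of
  \<open>b_j^n\<close> in \<open>x^v\<close>: multiplying \<open>x^v\<close> by \<open>1 = (x + (1 - x))^(n-v)\<close> and using the binomial
  theorem gives \<open>x^v = \<Sum>_j (C(j,v) / C(n,v)) b_j^n(x)\<close> (\<open>power_eq_sum_Bernstein\<close>). Interchanging
  the two sums thus exhibits the claimed numbers as one possible family of coefficients, and
  linear independence of the Bernstein polynomials (\<open>Bernstein_coeffs_unique\<close>) makes it the only
  one.
\<close>

lemma pochhammer_minus_of_nat:
  "pochhammer (- real a) v = (-1) ^ v * fact v * real (a choose v)"
proof -
  have "real (a choose v) = (-1) ^ v * pochhammer (- real a) v / fact v"
    by (simp add: binomial_gbinomial gbinomial_pochhammer)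
  hence "(-1) ^ v * fact v * real (a choose v) = ((-1) * (-1)) ^ v * pochhammer (- real a) v"
    unfolding power_mult_distrib by simp
  thus ?thesis by simp
qed

lemma pochhammer_one_plus_of_nat:
  "pochhammer (1 + real a) b = fact (a + b) / fact a"
  using pochhammer_product'[of "1::real" a b] by (simp flip: pochhammer_fact)

lemma higher_pderiv_pcompose_linear:
  fixes p :: "'a::idom poly"
  shows "(pderiv ^^ k) (p \<circ>\<^sub>p [:a, b:]) = smult (b ^ k) ((pderiv ^^ k) p \<circ>\<^sub>p [:a, b:])"
  by (induction k) (simp_all add: pderiv_smult pderiv_pcompose pderiv_pCons mult.commute)

lemma pcompose_power:
  fixes p q :: "'a::comm_semiring_1 poly"
  shows "p ^ k \<circ>\<^sub>p q = (p \<circ>\<^sub>p q) ^ k"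
  by (induction k) (simp_all add: pcompose_mult pcompose_1)

lemma shifted_legendre_poly_rodrigues:
  "shifted_legendre_poly k = smult (1 / fact k) ((pderiv ^^ k) (monom 1 k * [:-1, 1:] ^ k))"
proof -
  have "([:-1, 0, 1:] ^ k) \<circ>\<^sub>p [:-1, 2:] = ([:-1, 0, 1:] \<circ>\<^sub>p [:-1, 2:] :: real poly) ^ k"
    by (rule pcompose_power)
  also have "([:-1, 0, 1:] \<circ>\<^sub>p [:-1, 2:] :: real poly) = smult 4 ([:0, 1:] * [:-1, 1:])"
    by (simp add: pcompose_pCons)
  also have "\<dots> ^ k = smult (4 ^ k) (monom 1 k * [:-1, 1:] ^ k)"
    by (simp only: smult_power power_mult_distrib monom_altdef smult_1_left)
  finally have "smult (2 ^ k) ((pderiv ^^ k) ([:-1, 0, 1:] ^ k) \<circ>\<^sub>p [:-1, 2:])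
      = smult (4 ^ k) ((pderiv ^^ k) (monom 1 k * [:-1, 1:] ^ k :: real poly))"
    by (metis higher_pderiv_pcompose_linear higher_pderiv_smult)
  hence "smult (1 / (4 ^ k * fact k))
           (smult (2 ^ k) ((pderiv ^^ k) ([:-1, 0, 1:] ^ k) \<circ>\<^sub>p [:-1, 2:]))
       = smult (1 / (4 ^ k * fact k))
           (smult (4 ^ k) ((pderiv ^^ k) (monom 1 k * [:-1, 1:] ^ k :: real poly)))"
    by simp
  moreover have "2 ^ k / (4 ^ k * fact k) = 1 / (2 ^ k * fact k :: real)"
    by (simp add: field_simps flip: power_mult_distrib)
  ultimately show ?thesis
    by (simp add: shifted_legendre_poly_def legendre_poly_def pcompose_smult)
qed

text \<open>
  The \<open>k\<close>-fold derivative of \<open>x^(k+v)\<close> contributes \<open>(k+v)!/v!\<close>, which after division by \<open>k!\<close>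
  is \<open>(1+k)_v / (1)_v\<close>; the binomial coefficient of \<open>(x - 1)^k\<close> contributes \<open>(-k)_v / v!\<close> up to
  sign. Both sides vanish for \<open>v > k\<close>.
\<close>

lemma coeff_shifted_legendre_poly:
  "coeff (shifted_legendre_poly k) v =
     (-1) ^ k * (pochhammer (- real k) v * pochhammer (1 + real k) v / (pochhammer 1 v * fact v))"
proof -
  have coeff_power: "coeff ([:-1, 1:] ^ k) v = (-1) ^ (k - v) * real (k choose v)"
    by (cases "v \<le> k") (simp_all add: coeff_linear_poly_power coeff_eq_0 degree_power_eq)
  have sign: "(-1) ^ (k - v) * real (k choose v) = (-1) ^ k * (-1) ^ v * real (k choose v)"
    by (cases "v \<le> k") (simp_all add: minus_one_power_iff)
  have "coeff (shifted_legendre_poly k) v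
      = pochhammer (1 + real v) k / fact k * ((-1) ^ (k - v) * real (k choose v))"
    by (simp add: shifted_legendre_poly_rodrigues coeff_higher_pderiv coeff_monom_mult
        coeff_power)
  also have "\<dots> = fact (k + v) / (fact v * fact k) * ((-1) ^ k * (-1) ^ v * real (k choose v))"
    unfolding sign by (simp add: pochhammer_one_plus_of_nat add.commute)
  finally show ?thesis
    by (simp add: pochhammer_minus_of_nat pochhammer_one_plus_of_nat mult_ac flip: pochhammer_fact)
qed

text \<open>
  The binomial theorem for \<open>x^v (x + (1 - x))^(n-v)\<close>, together with
  \<open>C(n,j) C(j,v) = C(n,v) C(n-v,j-v)\<close>.
\<close>

lemma power_eq_sum_Bernstein:
  assumes "v \<le> n"
  shows "x ^ v = (\<Sum>j\<le>n. real (j choose v) / real (n choose v) * Bernstein n j x)"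
proof -
  have "(\<Sum>j\<le>n. real (j choose v) / real (n choose v) * Bernstein n j x)
      = (\<Sum>j\<in>{v..n}. real (j choose v) / real (n choose v) * Bernstein n j x)"
    by (rule sum.mono_neutral_right) auto
  also have "\<dots> = (\<Sum>j\<in>{v..n}. real ((n - v) choose (j - v)) * x ^ j * (1 - x) ^ (n - j))"
  proof (rule sum.cong)
    fix j assume "j \<in> {v..n}"
    hence "real (n choose j) * real (j choose v) = real (n choose v) * real ((n - v) choose (j - v))"
      using choose_mult[of v j n] by (simp flip: of_nat_mult)
    thus "real (j choose v) / real (n choose v) * Bernstein n j x
        = real ((n - v) choose (j - v)) * x ^ j * (1 - x) ^ (n - j)"
      using assms by (simp add: Bernstein_def field_simps)
  qed simp
  also have "\<dots> = (\<Sum>i\<le>n - v. real ((n - v) choose i) * x ^ (i + v) * (1 - x) ^ (n - v - i))"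
    by (rule sum.reindex_bij_witness[of _ "\<lambda>i. i + v" "\<lambda>j. j - v"]) (use assms in auto)
  also have "\<dots> = x ^ v * (x + (1 - x)) ^ (n - v)"
    unfolding binomial_ring sum_distrib_left by (simp add: power_add mult_ac)
  finally show ?thesis by simp
qed

text \<open>
  Substituting \<open>x = t / (1 + t)\<close> and clearing the factor \<open>(1 + t)^n\<close> turns a combination of
  Bernstein polynomials into an ordinary polynomial in \<open>t\<close> with coefficients \<open>c_j C(n,j)\<close>. It
  vanishes for all \<open>t > 0\<close>, which is infinitely often.
\<close>

lemma Bernstein_independent:
  assumes zero: "\<And>x. (\<Sum>j\<le>n. c j * Bernstein n j x) = 0" and "j \<le> n"
  shows "c j = 0"
proof -
  have "(\<Sum>j\<le>n. (c j * real (n choose j)) * t ^ j) = 0" if "t > 0" for t :: real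
  proof -
    have "(c j * real (n choose j)) * t ^ j = (1 + t) ^ n * (c j * Bernstein n j (t / (1 + t)))"
      if "j \<le> n" for j
    proof -
      have "1 - t / (1 + t) = 1 / (1 + t)" using \<open>t > 0\<close> by (simp add: field_simps)
      moreover have "(1 + t) ^ n = (1 + t) ^ j * (1 + t) ^ (n - j)"
        using that by (simp flip: power_add)
      ultimately show ?thesis
        using \<open>t > 0\<close> by (simp add: Bernstein_def power_divide)
    qed
    hence "(\<Sum>j\<le>n. (c j * real (n choose j)) * t ^ j)
        = (1 + t) ^ n * (\<Sum>j\<le>n. c j * Bernstein n j (t / (1 + t)))"
      unfolding sum_distrib_left by (intro sum.cong) auto
    thus ?thesis by (simp add: zero)
  qed
  hence "{0<..} \<subseteq> {t::real. (\<Sum>j\<le>n. (c j * real (n choose j)) * t ^ j) = 0}" by auto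
  hence "infinite {t::real. (\<Sum>j\<le>n. (c j * real (n choose j)) * t ^ j) = 0}"
    using infinite_Ioi finite_subset by blast
  hence "c j * real (n choose j) = 0"
    using polyfun_finite_roots[of "\<lambda>j. c j * real (n choose j)" n] \<open>j \<le> n\<close> by blast
  thus ?thesis using \<open>j \<le> n\<close> by simp
qed

lemma Bernstein_coeffs_unique:
  assumes "\<And>x. (\<Sum>j\<le>n. c j * Bernstein n j x) = (\<Sum>j\<le>n. d j * Bernstein n j x)" and "j \<le> n"
  shows "c j = d j"
  using Bernstein_independent[of "\<lambda>j. c j - d j" n j] assms
  by (simp add: left_diff_distrib sum_subtractf)

text \<open>
  For \<open>k \<le> n\<close> no denominator \<open>(-n)_v\<close> with \<open>v \<le> k\<close> vanishes, so the monomial expansion can be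
  rewritten term by term. The terms with \<open>j < v \<le> k\<close> contain \<open>(-j)_v = 0\<close>, which is why
  summing up to \<open>k\<close> agrees with the cut-off at \<open>min j k\<close>.
\<close>

lemma shifted_legendre_poly_Bernstein:
  assumes "k \<le> n"
  shows "poly (shifted_legendre_poly k) x =
    (\<Sum>j\<le>n. ((-1) ^ k * hyp3F2_upto (min j k) (- real k) (1 + real k) (- real j) 1 (- real n) 1)
             * Bernstein n j x)"
proof -
  define a where
    "a v = pochhammer (- real k) v * pochhammer (1 + real k) v / (pochhammer 1 v * fact v)" for v
  have hyp: "hyp3F2_upto (min j k) (- real k) (1 + real k) (- real j) 1 (- real n) 1
      = (\<Sum>v\<le>k. a v * (real (j choose v) / real (n choose v)))" for j
  proof -
    have "hyp3F2_upto (min j k) (- real k) (1 + real k) (- real j) 1 (- real n) 1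
      = (\<Sum>v\<le>min j k. a v * (pochhammer (- real j) v / pochhammer (- real n) v))"
      by (simp add: hyp3F2_upto_def a_def mult_ac)
    also have "\<dots> = (\<Sum>v\<le>min j k. a v * (real (j choose v) / real (n choose v)))"
      by (simp add: pochhammer_minus_of_nat)
    also have "\<dots> = (\<Sum>v\<le>k. a v * (real (j choose v) / real (n choose v)))"
      by (rule sum.mono_neutral_left) auto
    finally show ?thesis .
  qed
  have "degree (shifted_legendre_poly k) \<le> k"
    by (rule degree_le) (simp add: coeff_shifted_legendre_poly pochhammer_minus_of_nat)
  hence "poly (shifted_legendre_poly k) x = (\<Sum>v\<le>k. coeff (shifted_legendre_poly k) v * x ^ v)"
    unfolding poly_altdef by (intro sum.mono_neutral_left) (auto simp: coeff_eq_0)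
  also have "\<dots> = (\<Sum>v\<le>k. (-1) ^ k * a v * x ^ v)"
    by (simp add: coeff_shifted_legendre_poly a_def)
  also have "\<dots> = (\<Sum>v\<le>k. \<Sum>j\<le>n. (-1) ^ k * a v *
                     (real (j choose v) / real (n choose v) * Bernstein n j x))"
    using assms by (intro sum.cong refl) (simp add: power_eq_sum_Bernstein[of _ n] sum_distrib_left)
  also have "\<dots> = (\<Sum>j\<le>n. ((-1) ^ k * (\<Sum>v\<le>k. a v * (real (j choose v) / real (n choose v))))
                     * Bernstein n j x)"
    by (subst sum.swap) (simp add: sum_distrib_left sum_distrib_right mult_ac)
  finally show ?thesis by (simp add: hyp)
qed

theorem mainTheorem10:
  fixes n :: nat and m :: "nat \<Rightarrow> nat \<Rightarrow> real"
  assumes change_of_basis: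
    "\<And>k x. k \<le> n \<Longrightarrow>
       poly (shifted_legendre_poly k) x = (\<Sum>j\<le>n. m j k * Bernstein n j x)"
  shows "\<forall>j\<le>n. \<forall>k\<le>n.
           m j k = (-1) ^ k *
             hyp3F2_upto (min j k) (- real k) (1 + real k) (- real j) 1 (- real n) 1"
proof (intro allI impI)
  fix j k assume "j \<le> n" "k \<le> n"
  show "m j k = (-1) ^ k *
          hyp3F2_upto (min j k) (- real k) (1 + real k) (- real j) 1 (- real n) 1"
    by (rule Bernstein_coeffs_unique[OF _ \<open>j \<le> n\<close>])
       (use \<open>k \<le> n\<close> change_of_basis shifted_legendre_poly_Bernstein in simp)
qed

end
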